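(* Let $(U,g)$ be a metric structure and let $h$ be a gauge metric field for $g$, i.e. a non-singular smooth $(1,1)$-extensor field with $g=h^{\dagger}\circ\eta\circ h$, $\eta$ an orthogonal metric field with the same signature as $g$. Then the gauge covariant divergence, curl and gradient operators satisfy, for all $X\in\mathcal{M}(U)$, $$\underline{h}^{*}(D^{-}\lrcorner_{g^{-1}}X)=\mathbf{D}^{-}\lrcorner_{\eta}\,\underline{h}^{*}(X),$$ $$\underline{h}^{*}(D^{-}\wedge X)=\mathbf{D}^{-}\wedge\underline{h}^{*}(X),$$ $$\underline{h}^{*}(D^{-}\diamond_{g^{-1}}X)=\mathbf{D}^{-}\diamond_{\eta}\,\underline{h}^{*}(X),$$ where $\diamond_m$ denotes the $m$-Clifford product.
   Context: $M$ is an $n$-dimensional smooth manifold, $(U_o,\phi_o)$ a chart with coordinates $x^1,\dots,x^n$, and $U\subset U_o$ open. The canonical space $\mathcal{U}_o$ is an $n$-dimensional real vector space with basis $b_1,\dots,b_n$ and the Euclidean scalar product $b_\mu\cdot b_\nu=\delta_{\mu\nu}$, extended to $\bigwedge\mathcal{U}_o$ by determinants. $\mathcal{V}(U),\mathcal{M}(U)$ denote smooth maps from $U$ to $\mathcal{U}_o,\bigwedge\mathcal{U}_o$. For $a\in\mathcal{U}_o$, $a\cdot\partial_o X=\sum_\mu(a\cdot b_\mu)\,\partial X/\partial x^\mu$; for an endomorphism field $g$, $(a\cdot\partial_og)(b)=a\cdot\partial_o(g(b))-g(a\cdot\partial_ob)$. $v\lrcorner X$ is the Euclidean interior product by a vector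 $v$. ${}^\dagger$ is the Euclidean adjoint, $t^*=(t^{-1})^\dagger$, $\underline t$ the exterior-algebra extension of $t$. Metric field: smooth field $g$ of endomorphisms with $g=g^\dagger$, $\det[g]\neq0$; orthogonal metric field: metric field $\eta$ with $\eta=\eta^\dagger=\eta^{-1}$. For a metric $m$ and a vector $v$: $v\lrcorner_mX=m(v)\lrcorner X$, $v\diamond_mX=v\lrcorner_mX+v\wedge X$ (Clifford product). Levi-Civita connection field: $\lambda_a(b)=\frac12g^{-1}\circ(a\cdot\partial_og)(b)+\omega_0(a)\times_gb$ with $\omega_0(a)=-\frac14\sum_{\mu,\nu}a\cdot((b_\mu\cdot\partial_og)(b_\nu)-(b_\nu\cdot\partial_og)(b_\mu))\,g^{-1}(b_\mu)\wedge g^{-1}(b_\nu)$ and $B\times_gb=-g(b)\lrcorner B$; $\Lambda_a(X)=\sum_\mu\lambda_a(b_\mu)\wedge(b_\mu\lrcorner X)$; $D_a^{-}X=a\cdot\partial_oX-\Lambda_a^{\dagger}(X)$. Levi-Civita derivatives: $D^{-}\lrcorner_{g^{-1}}X=\sum_\mu b_\mu\lrcorner_{g^{-1}}(D_{b_\mu}^{-}X)$, $D^{-}\wedge X=\sum_\mu b_\mu\wedge(D_{b_\mu}^{-}X)$, $D^{-}\diamond_{g^{-1}}X=\sum_\mu b_\mu\diamond_{g^{-1}}(D_{b_\mu}^{-}X)$. Gauge (deformed) covariant derivative: $\mathbf{D}_{h^{*}a}^{-}X=\underline{h}^{*}(D_a^{-}\underline{h}^{\dagger}(X))$ (the symbol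 $\mathbf{D}_{h^*a}^-$ is defined by this formula). Gauge divergence, curl, gradient: $\mathbf{D}^{-}\lrcorner_\eta X=\sum_\mu h^{*}(b_\mu)\lrcorner_\eta(\mathbf{D}_{h^{*}b_\mu}^{-}X)$, $\mathbf{D}^{-}\wedge X=\sum_\mu h^{*}(b_\mu)\wedge(\mathbf{D}_{h^{*}b_\mu}^{-}X)$, $\mathbf{D}^{-}\diamond_\eta X=\sum_\mu h^{*}(b_\mu)\diamond_\eta(\mathbf{D}_{h^{*}b_\mu}^{-}X)$. *)

theory Defs
  imports "HOL-Analysis.Analysis" "HOL-Combinatorics.Permutations"
begin

section \<open>Smooth maps, manifolds and charts\<close>

definition partial :: "'n::finite \<Rightarrow> (real^'n \<Rightarrow> 'b::real_normed_vector) \<Rightarrow> real^'n \<Rightarrow> 'b" where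
  "partial \<mu> F x = vector_derivative (\<lambda>t. F (x + t *\<^sub>R axis \<mu> 1)) (at 0)"

primrec Ck_on :: "nat \<Rightarrow> (real^'n::finite) set \<Rightarrow> (real^'n \<Rightarrow> 'b::real_normed_vector) \<Rightarrow> bool" where
  "Ck_on 0 W F \<longleftrightarrow> continuous_on W F"
| "Ck_on (Suc k) W F \<longleftrightarrow> (\<forall>x\<in>W. F differentiable (at x)) \<and> (\<forall>\<mu>. Ck_on k W (partial \<mu> F))"

text \<open>Only used for open \<open>W\<close>.\<close>

definition smooth_on :: "(real^'n::finite) set \<Rightarrow> (real^'n \<Rightarrow> 'b::real_normed_vector) \<Rightarrow> bool" where
  "smooth_on W F \<longleftrightarrow> (\<forall>k. Ck_on k W F)"

text \<open>A chart is a pair \<open>(U\<^sub>o, \<phi>\<^sub>o)\<close>; the map \<open>\<phi>\<^sub>o\<close> is relevant on \<open>U\<^sub>o\<close> only.\<close>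

type_synonym ('m, 'n) chart = "'m set \<times> ('m \<Rightarrow> real^'n)"

definition chart_inv :: "('m, 'n::finite) chart \<Rightarrow> real^'n \<Rightarrow> 'm" where
  "chart_inv c = inv_into (fst c) (snd c)"

definition is_chart :: "('m::topological_space, 'n::finite) chart \<Rightarrow> bool" where
  "is_chart c \<longleftrightarrow> open (fst c) \<and> open (snd c ` fst c)
     \<and> homeomorphism (fst c) (snd c ` fst c) (snd c) (chart_inv c)"

definition smooth_atlas :: "('m::topological_space, 'n::finite) chart set \<Rightarrow> bool" where
  "smooth_atlas A \<longleftrightarrow> (\<forall>c\<in>A. is_chart c) \<and> (\<Union>c\<in>A. fst c) = UNIV
     \<and> (\<forall>c\<in>A. \<forall>c'\<in>A. smooth_on (snd c ` (fst c \<inter> fst c')) (snd c' \<circ> chart_inv c))"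

definition smooth_field :: "('m, 'n::finite) chart \<Rightarrow> 'm set \<Rightarrow> ('m \<Rightarrow> 'b::real_normed_vector) \<Rightarrow> bool" where
  "smooth_field c U X \<longleftrightarrow> smooth_on (snd c ` U) (X \<circ> chart_inv c)"


section \<open>The exterior algebra of the canonical space\<close>

text \<open>The canonical space is \<open>real^'n\<close>, with \<open>b\<^sub>1, \<dots>, b\<^sub>n\<close> the standard basis in the order of
  the index type. Multivectors are given by their coordinates with respect to the basis
  \<open>b\<^sub>S = b\<^bsub>s\<^sub>1\<^esub> \<and> \<dots> \<and> b\<^bsub>s\<^sub>k\<^esub>\<close>, \<open>S = {s\<^sub>1 < \<dots> < s\<^sub>k}\<close>; the empty set indexes the scalars.
  The scalar product on multivectors is \<open>inner\<close>: see \<open>inner_blades\<close> below for the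
  determinant formula.\<close>

type_synonym 'n cs = "real^'n"
type_synonym 'n mv = "real^('n set)"

abbreviation (input) bas :: "'n::finite \<Rightarrow> 'n cs" where
  "bas \<mu> \<equiv> axis \<mu> 1"

text \<open>\<open>b\<^sub>S \<and> b\<^sub>T = wsign S T b\<^bsub>S \<union> T\<^esub>\<close> for disjoint \<open>S\<close> and \<open>T\<close>: the sign counts the inversions.\<close>

definition wsign :: "'n::linorder set \<Rightarrow> 'n set \<Rightarrow> real" where
  "wsign S T = (-1) ^ card {(i, j). i \<in> S \<and> j \<in> T \<and> j < i}"

definition wedge :: "('n::{finite,linorder}) mv \<Rightarrow> 'n mv \<Rightarrow> 'n mv"  (infixr "\<^bold>\<and>" 70) where
  "X \<^bold>\<and> Y = (\<chi> R. \<Sum>S\<in>Pow R. wsign S (R - S) * X $ S * Y $ (R - S))"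

definition mvec :: "'n::finite cs \<Rightarrow> 'n mv" where
  "mvec v = (\<Sum>i\<in>UNIV. v $ i *\<^sub>R axis {i} 1)"

definition grade1 :: "'n::finite mv \<Rightarrow> 'n cs" where
  "grade1 X = (\<chi> i. X $ {i})"

definition wedge_list :: "('n::{finite,linorder} cs) list \<Rightarrow> 'n mv" where
  "wedge_list vs = foldr (\<lambda>v X. mvec v \<^bold>\<and> X) vs (axis {} 1)"

text \<open>The exterior-algebra extension of an endomorphism.\<close>

definition ext :: "('n::{finite,linorder} cs \<Rightarrow> 'n cs) \<Rightarrow> 'n mv \<Rightarrow> 'n mv" where
  "ext t X = (\<Sum>S\<in>UNIV. X $ S *\<^sub>R wedge_list (map (\<lambda>i. t (bas i)) (sorted_list_of_set S)))"

text \<open>The interior product is the transpose of the exterior product: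
  \<open>(v \<lrcorner> X) \<bullet> Y = X \<bullet> (v \<and> Y)\<close>.\<close>

definition iprod :: "'n::{finite,linorder} cs \<Rightarrow> 'n mv \<Rightarrow> 'n mv" where
  "iprod v = adjoint (\<lambda>Y. mvec v \<^bold>\<and> Y)"

definition iprod_metric :: "('n::{finite,linorder} cs \<Rightarrow> 'n cs) \<Rightarrow> 'n cs \<Rightarrow> 'n mv \<Rightarrow> 'n mv" where
  "iprod_metric m v X = iprod (m v) X"

definition clifford :: "('n::{finite,linorder} cs \<Rightarrow> 'n cs) \<Rightarrow> 'n cs \<Rightarrow> 'n mv \<Rightarrow> 'n mv" where
  "clifford m v X = iprod_metric m v X + mvec v \<^bold>\<and> X"

text \<open>\<open>t\<^sup>* = (t\<^sup>-\<^sup>1)\<^sup>\<dagger>\<close>.\<close>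

definition star :: "('n::finite cs \<Rightarrow> 'n cs) \<Rightarrow> 'n cs \<Rightarrow> 'n cs" where
  "star t = adjoint (inv t)"

subsection \<open>The coordinate model is the exterior algebra\<close>

lemma wedge_nth: "(X \<^bold>\<and> Y) $ R = (\<Sum>S\<in>Pow R. wsign S (R - S) * X $ S * Y $ (R - S))"
  by (simp add: wedge_def)

lemma bilinear_wedge: "bilinear (\<^bold>\<and>)"
  unfolding bilinear_def
  by (auto intro!: linearI simp: vec_eq_iff wedge_nth algebra_simps sum.distrib sum_distrib_left)

lemma wsign_Un_left:
  fixes S T Q :: "'n::{finite,linorder} set"
  assumes "S \<inter> T = {}"
  shows "wsign (S \<union> T) Q = wsign S Q * wsign T Q"
proof -
  have "{(i, j). i \<in> S \<union> T \<and> j \<in> Q \<and> j < i}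
      = {(i, j). i \<in> S \<and> j \<in> Q \<and> j < i} \<union> {(i, j). i \<in> T \<and> j \<in> Q \<and> j < i}" by auto
  moreover have "{(i, j). i \<in> S \<and> j \<in> Q \<and> j < i} \<inter> {(i, j). i \<in> T \<and> j \<in> Q \<and> j < i} = {}"
    using assms by auto
  ultimately show ?thesis
    by (simp add: wsign_def card_Un_disjoint power_add)
qed

lemma wsign_Un_right:
  fixes S T Q :: "'n::{finite,linorder} set"
  assumes "T \<inter> Q = {}"
  shows "wsign S (T \<union> Q) = wsign S T * wsign S Q"
proof -
  have "{(i, j). i \<in> S \<and> j \<in> T \<union> Q \<and> j < i}
      = {(i, j). i \<in> S \<and> j \<in> T \<and> j < i} \<union> {(i, j). i \<in> S \<and> j \<in> Q \<and> j < i}" by auto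
  moreover have "{(i, j). i \<in> S \<and> j \<in> T \<and> j < i} \<inter> {(i, j). i \<in> S \<and> j \<in> Q \<and> j < i} = {}"
    using assms by auto
  ultimately show ?thesis
    by (simp add: wsign_def card_Un_disjoint power_add)
qed

lemma wedge_assoc: "(X \<^bold>\<and> Y) \<^bold>\<and> Z = X \<^bold>\<and> (Y \<^bold>\<and> Z)"
proof -
  have "((X \<^bold>\<and> Y) \<^bold>\<and> Z) $ R = (X \<^bold>\<and> (Y \<^bold>\<and> Z)) $ R" for R
  proof -
    have "((X \<^bold>\<and> Y) \<^bold>\<and> Z) $ R
        = (\<Sum>P\<in>Pow R. \<Sum>S\<in>Pow P.
            wsign P (R - P) * wsign S (P - S) * X $ S * Y $ (P - S) * Z $ (R - P))"
      by (simp add: wedge_nth sum_distrib_left sum_distrib_right mult.assoc)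
    also have "\<dots> = (\<Sum>(P, S)\<in>(SIGMA P:Pow R. Pow P).
            wsign P (R - P) * wsign S (P - S) * X $ S * Y $ (P - S) * Z $ (R - P))"
      by (rule sum.Sigma) auto
    also have "\<dots> = (\<Sum>(S, T)\<in>(SIGMA S:Pow R. Pow (R - S)).
            wsign S (R - S) * wsign T (R - S - T) * X $ S * Y $ T * Z $ (R - S - T))"
    proof (rule sum.reindex_bij_witness
        [where i = "\<lambda>(S, T). (S \<union> T, S)" and j = "\<lambda>(P, S). (S, P - S)"], goal_cases)
      case (5 a)
      then obtain P S where a: "a = (P, S)" and PS: "P \<subseteq> R" "S \<subseteq> P" by auto
      have P: "P = S \<union> (P - S)" and Q: "R - S = (P - S) \<union> (R - P)" "R - S - (P - S) = R - P"
        using PS by auto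
      have "wsign P (R - P) = wsign S (R - P) * wsign (P - S) (R - P)"
        by (subst P, rule wsign_Un_left) auto
      moreover have "wsign S (R - S) = wsign S (P - S) * wsign S (R - P)"
        unfolding Q(1) by (rule wsign_Un_right) auto
      ultimately show ?case by (simp add: a Q(2))
    qed auto
    also have "\<dots> = (\<Sum>S\<in>Pow R. \<Sum>T\<in>Pow (R - S).
            wsign S (R - S) * wsign T (R - S - T) * X $ S * Y $ T * Z $ (R - S - T))"
      by (rule sum.Sigma[symmetric]) auto
    also have "\<dots> = (X \<^bold>\<and> (Y \<^bold>\<and> Z)) $ R"
      by (simp add: wedge_nth sum_distrib_left mult_ac)
    finally show ?thesis .
  qed
  then show ?thesis by (simp add: vec_eq_iff)
qed

lemma wedge_blades:
  "axis S 1 \<^bold>\<and> axis T 1 = (if S \<inter> T = {} then wsign S T *\<^sub>R axis (S \<union> T) 1 else 0)"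
proof -
  have "(axis S 1 \<^bold>\<and> axis T 1) $ R
      = (if S \<inter> T = {} \<and> R = S \<union> T then wsign S T else 0)" for R :: "'a set"
  proof -
    have "(axis S 1 \<^bold>\<and> axis T 1) $ R
        = (\<Sum>P\<in>Pow R. if P = S then (if R - S = T then wsign S T else 0) else 0)"
      unfolding wedge_nth by (rule sum.cong) (auto simp: axis_def)
    also have "\<dots> = (if S \<subseteq> R \<and> R - S = T then wsign S T else 0)"
      by (simp add: sum.delta)
    also have "S \<subseteq> R \<and> R - S = T \<longleftrightarrow> S \<inter> T = {} \<and> R = S \<union> T" by auto
    finally show ?thesis .
  qed
  then show ?thesis by (auto simp: vec_eq_iff axis_def)
qed

lemma mvec_bas: "mvec (bas i) = axis {i} 1"
proof -
  have "mvec (bas i) = (\<Sum>j\<in>UNIV. if j = i then axis {i} 1 else (0 :: 'a mv))"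
    unfolding mvec_def by (rule sum.cong) (auto simp: axis_def)
  then show ?thesis by simp
qed

lemma wedge_mvec_anticommute: "mvec v \<^bold>\<and> mvec w = - (mvec w \<^bold>\<and> mvec v)"
proof -
  have expand: "mvec x \<^bold>\<and> mvec y = (\<Sum>i\<in>UNIV. \<Sum>j\<in>UNIV. (x $ i * y $ j) *\<^sub>R (axis {i} 1 \<^bold>\<and> axis {j} 1))"
    for x y :: "'a cs"
    unfolding mvec_def bilinear_sum[OF bilinear_wedge]
    by (simp add: sum.cartesian_product bilinear_lmul[OF bilinear_wedge]
        bilinear_rmul[OF bilinear_wedge] mult.commute)
  have "{(a, b). a \<in> {i} \<and> b \<in> {j} \<and> b < a} = (if j < i then {(i, j)} else {})" for i j :: 'a
    by auto
  then have sgn: "wsign {i} {j} = (if j < i then -1 else 1)" for i j :: 'a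
    by (simp add: wsign_def)
  have anti: "axis {i} 1 \<^bold>\<and> axis {j} 1 = - (axis {j} 1 \<^bold>\<and> axis {i} 1 :: 'a mv)" for i j
    by (cases i j rule: linorder_cases) (auto simp: wedge_blades sgn insert_commute)
  have "mvec v \<^bold>\<and> mvec w = (\<Sum>j\<in>UNIV. \<Sum>i\<in>UNIV. (v $ i * w $ j) *\<^sub>R (axis {i} 1 \<^bold>\<and> axis {j} 1))"
    unfolding expand by (rule sum.swap)
  also have "\<dots> = - (mvec w \<^bold>\<and> mvec v)"
    unfolding expand sum_negf[symmetric]
    by (intro sum.cong refl, subst anti) (simp add: mult.commute)
  finally show ?thesis .
qed

corollary wedge_mvec_self: "mvec v \<^bold>\<and> mvec v = 0"
proof -
  have "mvec v \<^bold>\<and> mvec v = - (mvec v \<^bold>\<and> mvec v)" by (rule wedge_mvec_anticommute)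
  then show ?thesis by (simp add: eq_neg_iff_add_eq_0 scaleR_2[symmetric])
qed

lemma wedge_one: "axis {} 1 \<^bold>\<and> X = X" "X \<^bold>\<and> axis {} 1 = X"
proof -
  have "(axis {} 1 \<^bold>\<and> X) $ R = (\<Sum>S\<in>Pow R. if S = {} then X $ R else 0)" for R
    unfolding wedge_nth by (rule sum.cong) (auto simp: axis_def wsign_def)
  then show "axis {} 1 \<^bold>\<and> X = X" by (simp add: vec_eq_iff)
  have "(X \<^bold>\<and> axis {} 1) $ R = (\<Sum>S\<in>Pow R. if S = R then X $ R else 0)" for R
  proof -
    have "{(i, j). i \<in> R \<and> j \<in> {} \<and> j < i} = {}" for R :: "'a set" by auto
    then have "wsign R {} = 1" for R :: "'a set" unfolding wsign_def by (metis card.empty power_0)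
    then show ?thesis unfolding wedge_nth by (intro sum.cong) (auto simp: axis_def)
  qed
  then show "X \<^bold>\<and> axis {} 1 = X" by (simp add: vec_eq_iff)
qed

lemma wedge_list_bas: "wedge_list (map bas (sorted_list_of_set S)) = axis S 1"
proof -
  have "wedge_list (map bas xs) = axis (set xs) 1" if "sorted_wrt (<) xs" for xs :: "'a list"
    using that
  proof (induction xs)
    case (Cons i xs)
    have "{(a, j). a \<in> {i} \<and> j \<in> set xs \<and> j < a} = {}" using Cons.prems by auto
    then have "wsign {i} (set xs) = 1" unfolding wsign_def by (metis card.empty power_0)
    moreover have "i \<notin> set xs" using Cons.prems by auto
    ultimately show ?case using Cons by (simp add: wedge_list_def mvec_bas wedge_blades)
  qed (simp add: wedge_list_def)
  from this[of "sorted_list_of_set S"] show ?thesis by simp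
qed

lemma inner_blades:
  fixes S T :: "'n::{finite,linorder} set"
  defines "s \<equiv> sorted_list_of_set S" and "t \<equiv> sorted_list_of_set T"
  assumes card: "card S = card T"
  shows "(axis S 1 :: 'n mv) \<bullet> axis T 1
    = (\<Sum>\<pi> | \<pi> permutes {..<card S}. of_int (sign \<pi>) * (\<Prod>i<card S. bas (s ! i) \<bullet> bas (t ! \<pi> i)))"
proof (cases "S = T")
  case True
  have "(\<Prod>i<card S. bas (s ! i) \<bullet> bas (t ! \<pi> i)) = (if \<pi> = id then 1 else 0)"
    if \<pi>: "\<pi> permutes {..<card S}" for \<pi>
  proof (cases "\<pi> = id")
    case False
    then obtain i where i: "\<pi> i \<noteq> i" by (auto simp: fun_eq_iff)
    then have "i < card S" using \<pi> by (auto simp: permutes_def)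
    moreover have "\<pi> i < card S" using \<pi> \<open>i < card S\<close> permutes_in_image[of \<pi> "{..<card S}" i] by simp
    ultimately have "s ! i \<noteq> t ! \<pi> i"
      using i True by (simp add: s_def t_def nth_eq_iff_index_eq)
    then have "bas (s ! i) \<bullet> bas (t ! \<pi> i) = 0" by (simp add: inner_axis_axis)
    then show ?thesis using False \<open>i < card S\<close> by (auto intro!: prod_zero)
  qed (simp add: True s_def t_def inner_axis_axis)
  then have "(\<Sum>\<pi> | \<pi> permutes {..<card S}. of_int (sign \<pi>) * (\<Prod>i<card S. bas (s ! i) \<bullet> bas (t ! \<pi> i)))
      = (\<Sum>\<pi> | \<pi> permutes {..<card S}. if \<pi> = id then 1 else 0)"
    by (intro sum.cong) (auto simp: sign_id)
  also have "\<dots> = 1" by (simp add: finite_permutations permutes_id)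
  finally show ?thesis using True by (simp add: inner_axis_axis)
next
  case False
  have "\<not> S \<subseteq> T" using False card card_subset_eq[of T S] by auto
  then obtain x where x: "x \<in> S" "x \<notin> T" by auto
  then have "x \<in> set s" by (simp add: s_def)
  then obtain i where i: "i < card S" "s ! i = x"
    unfolding in_set_conv_nth by (auto simp: s_def)
  have "(\<Prod>i<card S. bas (s ! i) \<bullet> bas (t ! \<pi> i)) = 0" if \<pi>: "\<pi> permutes {..<card S}" for \<pi>
  proof (rule prod_zero)
    have "\<pi> i < length t" using \<pi> i permutes_in_image[of \<pi> "{..<card S}" i] card by (simp add: t_def)
    then have "t ! \<pi> i \<in> set t" by (rule nth_mem)
    then have "bas (s ! i) \<bullet> bas (t ! \<pi> i) = 0" using x i by (auto simp: t_def inner_axis_axis)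
    then show "\<exists>i\<in>{..<card S}. bas (s ! i) \<bullet> bas (t ! \<pi> i) = 0" using i by auto
  qed simp
  then have "(\<Sum>\<pi> | \<pi> permutes {..<card S}. of_int (sign \<pi>) * (\<Prod>i<card S. bas (s ! i) \<bullet> bas (t ! \<pi> i)))
      = (0 :: real)"
    by (intro sum.neutral) auto
  then show ?thesis using False by (simp only: inner_axis_axis) simp
qed

lemma iprod_inner: "iprod v X \<bullet> Y = X \<bullet> (mvec v \<^bold>\<and> Y)"
proof -
  have "linear (\<lambda>Y. mvec v \<^bold>\<and> Y)" using bilinear_wedge by (auto simp: bilinear_def)
  then show ?thesis unfolding iprod_def by (rule adjoint_clauses(2))
qed


section \<open>Metric and gauge metric fields\<close>

text \<open>A \<open>(1,1)\<close>-extensor field is a field of endomorphisms of the canonical space; it is smooth as a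
  map into the endomorphisms, which are identified with their matrices.\<close>

definition extensor_field :: "('m, 'n::finite) chart \<Rightarrow> 'm set \<Rightarrow> ('m \<Rightarrow> 'n cs \<Rightarrow> 'n cs) \<Rightarrow> bool" where
  "extensor_field c U t \<longleftrightarrow> (\<forall>p\<in>U. linear (t p)) \<and> smooth_field c U (\<lambda>p. matrix (t p))"

definition nonsingular_on :: "'m set \<Rightarrow> ('m \<Rightarrow> 'n::finite cs \<Rightarrow> 'n cs) \<Rightarrow> bool" where
  "nonsingular_on U t \<longleftrightarrow> (\<forall>p\<in>U. det (matrix (t p)) \<noteq> 0)"

definition metric_field :: "('m, 'n::finite) chart \<Rightarrow> 'm set \<Rightarrow> ('m \<Rightarrow> 'n cs \<Rightarrow> 'n cs) \<Rightarrow> bool" where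
  "metric_field c U g \<longleftrightarrow> extensor_field c U g \<and> nonsingular_on U g \<and> (\<forall>p\<in>U. g p = adjoint (g p))"

definition metric_structure :: "('m::topological_space, 'n::finite) chart \<Rightarrow> 'm set \<Rightarrow> ('m \<Rightarrow> 'n cs \<Rightarrow> 'n cs) \<Rightarrow> bool" where
  "metric_structure c U g \<longleftrightarrow> open U \<and> U \<subseteq> fst c \<and> metric_field c U g"

definition orthogonal_metric_field :: "('m, 'n::finite) chart \<Rightarrow> 'm set \<Rightarrow> ('m \<Rightarrow> 'n cs \<Rightarrow> 'n cs) \<Rightarrow> bool" where
  "orthogonal_metric_field c U \<eta> \<longleftrightarrow> metric_field c U \<eta> \<and> (\<forall>p\<in>U. \<eta> p = inv (\<eta> p))"

text \<open>The signature of a symmetric endomorphism: the numbers of its positive and of its negative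
  eigenvalues, counted with multiplicity.\<close>

definition eigenvals :: "('n::finite cs \<Rightarrow> 'n cs) \<Rightarrow> real set" where
  "eigenvals t = {r. \<exists>v. v \<noteq> 0 \<and> t v = r *\<^sub>R v}"

definition signature :: "('n::finite cs \<Rightarrow> 'n cs) \<Rightarrow> nat \<times> nat" where
  "signature t =
    (\<Sum>r\<in>{r \<in> eigenvals t. 0 < r}. dim {v. t v = r *\<^sub>R v},
     \<Sum>r\<in>{r \<in> eigenvals t. r < 0}. dim {v. t v = r *\<^sub>R v})"

definition gauge_metric_field :: "('m, 'n::finite) chart \<Rightarrow> 'm set \<Rightarrow> ('m \<Rightarrow> 'n cs \<Rightarrow> 'n cs)
    \<Rightarrow> ('m \<Rightarrow> 'n cs \<Rightarrow> 'n cs) \<Rightarrow> ('m \<Rightarrow> 'n cs \<Rightarrow> 'n cs) \<Rightarrow> bool" where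
  "gauge_metric_field c U g \<eta> h \<longleftrightarrow>
     extensor_field c U h \<and> nonsingular_on U h \<and> orthogonal_metric_field c U \<eta>
     \<and> (\<forall>p\<in>U. signature (\<eta> p) = signature (g p))
     \<and> (\<forall>p\<in>U. g p = adjoint (h p) \<circ> \<eta> p \<circ> h p)"


section \<open>Levi-Civita and gauge derivatives\<close>

definition dird :: "('m, 'n::finite) chart \<Rightarrow> 'n cs \<Rightarrow> ('m \<Rightarrow> 'b::real_normed_vector) \<Rightarrow> 'm \<Rightarrow> 'b" where
  "dird c a X p = (\<Sum>\<mu>\<in>UNIV. (a \<bullet> bas \<mu>) *\<^sub>R partial \<mu> (X \<circ> chart_inv c) (snd c p))"

text \<open>\<open>(a \<cdot> \<partial>\<^sub>o g)(b)\<close> for a vector field \<open>b\<close>.\<close>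

definition dird_ext :: "('m, 'n::finite) chart \<Rightarrow> 'n cs \<Rightarrow> ('m \<Rightarrow> 'n cs \<Rightarrow> 'n cs)
    \<Rightarrow> ('m \<Rightarrow> 'n cs) \<Rightarrow> 'm \<Rightarrow> 'n cs" where
  "dird_ext c a g b p = dird c a (\<lambda>q. g q (b q)) p - g p (dird c a b p)"

definition omega0 :: "('m, 'n::{finite,linorder}) chart \<Rightarrow> ('m \<Rightarrow> 'n cs \<Rightarrow> 'n cs)
    \<Rightarrow> 'n cs \<Rightarrow> 'm \<Rightarrow> 'n mv" where
  "omega0 c g a p = - (1/4) *\<^sub>R (\<Sum>\<mu>\<in>UNIV. \<Sum>\<nu>\<in>UNIV.
     (a \<bullet> (dird_ext c (bas \<mu>) g (\<lambda>_. bas \<nu>) p - dird_ext c (bas \<nu>) g (\<lambda>_. bas \<mu>) p))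
       *\<^sub>R (mvec (inv (g p) (bas \<mu>)) \<^bold>\<and> mvec (inv (g p) (bas \<nu>))))"

text \<open>\<open>B \<times>\<^sub>g b\<close> for a bivector \<open>B\<close> and the metric \<open>m\<close> at a point.\<close>

definition comm_prod :: "('n::{finite,linorder} cs \<Rightarrow> 'n cs) \<Rightarrow> 'n mv \<Rightarrow> 'n cs \<Rightarrow> 'n cs" where
  "comm_prod m B b = - grade1 (iprod (m b) B)"

definition lc_lambda :: "('m, 'n::{finite,linorder}) chart \<Rightarrow> ('m \<Rightarrow> 'n cs \<Rightarrow> 'n cs)
    \<Rightarrow> 'n cs \<Rightarrow> ('m \<Rightarrow> 'n cs) \<Rightarrow> 'm \<Rightarrow> 'n cs" where
  "lc_lambda c g a b p =
     (1/2) *\<^sub>R inv (g p) (dird_ext c a g b p) + comm_prod (g p) (omega0 c g a p) (b p)"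

definition lc_Lambda :: "('m, 'n::{finite,linorder}) chart \<Rightarrow> ('m \<Rightarrow> 'n cs \<Rightarrow> 'n cs)
    \<Rightarrow> 'n cs \<Rightarrow> 'm \<Rightarrow> 'n mv \<Rightarrow> 'n mv" where
  "lc_Lambda c g a p X = (\<Sum>\<mu>\<in>UNIV. mvec (lc_lambda c g a (\<lambda>_. bas \<mu>) p) \<^bold>\<and> iprod (bas \<mu>) X)"

definition lc_deriv :: "('m, 'n::{finite,linorder}) chart \<Rightarrow> ('m \<Rightarrow> 'n cs \<Rightarrow> 'n cs)
    \<Rightarrow> 'n cs \<Rightarrow> ('m \<Rightarrow> 'n mv) \<Rightarrow> 'm \<Rightarrow> 'n mv" where
  "lc_deriv c g a X p = dird c a X p - adjoint (lc_Lambda c g a p) (X p)"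

definition lc_div :: "('m, 'n::{finite,linorder}) chart \<Rightarrow> ('m \<Rightarrow> 'n cs \<Rightarrow> 'n cs)
    \<Rightarrow> ('m \<Rightarrow> 'n mv) \<Rightarrow> 'm \<Rightarrow> 'n mv" where
  "lc_div c g X p = (\<Sum>\<mu>\<in>UNIV. iprod_metric (inv (g p)) (bas \<mu>) (lc_deriv c g (bas \<mu>) X p))"

definition lc_curl :: "('m, 'n::{finite,linorder}) chart \<Rightarrow> ('m \<Rightarrow> 'n cs \<Rightarrow> 'n cs)
    \<Rightarrow> ('m \<Rightarrow> 'n mv) \<Rightarrow> 'm \<Rightarrow> 'n mv" where
  "lc_curl c g X p = (\<Sum>\<mu>\<in>UNIV. mvec (bas \<mu>) \<^bold>\<and> lc_deriv c g (bas \<mu>) X p)"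

definition lc_grad :: "('m, 'n::{finite,linorder}) chart \<Rightarrow> ('m \<Rightarrow> 'n cs \<Rightarrow> 'n cs)
    \<Rightarrow> ('m \<Rightarrow> 'n mv) \<Rightarrow> 'm \<Rightarrow> 'n mv" where
  "lc_grad c g X p = (\<Sum>\<mu>\<in>UNIV. clifford (inv (g p)) (bas \<mu>) (lc_deriv c g (bas \<mu>) X p))"

text \<open>The symbol \<open>D\<^bsub>h\<^sup>* a\<^esub>\<close> of the gauge covariant derivative is indexed here by \<open>h\<close> and \<open>a\<close>.\<close>

definition gauge_deriv :: "('m, 'n::{finite,linorder}) chart \<Rightarrow> ('m \<Rightarrow> 'n cs \<Rightarrow> 'n cs)
    \<Rightarrow> ('m \<Rightarrow> 'n cs \<Rightarrow> 'n cs) \<Rightarrow> 'n cs \<Rightarrow> ('m \<Rightarrow> 'n mv) \<Rightarrow> 'm \<Rightarrow> 'n mv" where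
  "gauge_deriv c g h a X p = ext (star (h p)) (lc_deriv c g a (\<lambda>q. ext (adjoint (h q)) (X q)) p)"

definition gauge_div :: "('m, 'n::{finite,linorder}) chart \<Rightarrow> ('m \<Rightarrow> 'n cs \<Rightarrow> 'n cs)
    \<Rightarrow> ('m \<Rightarrow> 'n cs \<Rightarrow> 'n cs) \<Rightarrow> ('m \<Rightarrow> 'n cs \<Rightarrow> 'n cs) \<Rightarrow> ('m \<Rightarrow> 'n mv) \<Rightarrow> 'm \<Rightarrow> 'n mv" where
  "gauge_div c g \<eta> h X p =
     (\<Sum>\<mu>\<in>UNIV. iprod_metric (\<eta> p) (star (h p) (bas \<mu>)) (gauge_deriv c g h (bas \<mu>) X p))"

definition gauge_curl :: "('m, 'n::{finite,linorder}) chart \<Rightarrow> ('m \<Rightarrow> 'n cs \<Rightarrow> 'n cs)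
    \<Rightarrow> ('m \<Rightarrow> 'n cs \<Rightarrow> 'n cs) \<Rightarrow> ('m \<Rightarrow> 'n mv) \<Rightarrow> 'm \<Rightarrow> 'n mv" where
  "gauge_curl c g h X p =
     (\<Sum>\<mu>\<in>UNIV. mvec (star (h p) (bas \<mu>)) \<^bold>\<and> gauge_deriv c g h (bas \<mu>) X p)"

definition gauge_grad :: "('m, 'n::{finite,linorder}) chart \<Rightarrow> ('m \<Rightarrow> 'n cs \<Rightarrow> 'n cs)
    \<Rightarrow> ('m \<Rightarrow> 'n cs \<Rightarrow> 'n cs) \<Rightarrow> ('m \<Rightarrow> 'n cs \<Rightarrow> 'n cs) \<Rightarrow> ('m \<Rightarrow> 'n mv) \<Rightarrow> 'm \<Rightarrow> 'n mv" where
  "gauge_grad c g \<eta> h X p =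
     (\<Sum>\<mu>\<in>UNIV. clifford (\<eta> p) (star (h p) (bas \<mu>)) (gauge_deriv c g h (bas \<mu>) X p))"

end

theory Submission
  imports Defs
begin

text \<open>Both sides of each identity are pushed through the algebra map \<open>ext (h\<^sup>*)\<close>. Since
  \<open>ext (h\<^sup>\<dagger>)\<close> inverts it on the open set \<open>U\<close>, the gauge derivative of \<open>ext (h\<^sup>*) X\<close> is
  \<open>ext (h\<^sup>*)\<close> of the Levi-Civita derivative of \<open>X\<close>. It remains that \<open>ext t\<close> is multiplicative
  and satisfies \<open>v \<lrcorner> ext t X = ext t (t\<^sup>\<dagger> v \<lrcorner> X)\<close>, which follows from \<open>v \<lrcorner> \<cdot>\<close> being
  an antiderivation; and \<open>(h\<^sup>*)\<^sup>\<dagger> \<eta> h\<^sup>* = h\<^sup>-\<^sup>1 \<eta> h\<^sup>* = g\<^sup>-\<^sup>1\<close>.\<close>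

section \<open>Linearity of the operations and reduction to basis elements\<close>

lemma linear_wedge_left: "linear (\<lambda>X. X \<^bold>\<and> Y)"
  and linear_wedge_right: "linear (\<lambda>Y. X \<^bold>\<and> Y)"
  using bilinear_wedge by (auto simp: bilinear_def)

lemma linear_mvec: "linear (mvec :: 'n::finite cs \<Rightarrow> 'n mv)"
  by (rule linearI) (simp_all add: mvec_def algebra_simps sum.distrib scaleR_right.sum)

lemma linear_ext: "linear (ext t)"
  by (rule linearI) (simp_all add: ext_def algebra_simps sum.distrib scaleR_right.sum)

lemma linear_iprod: "linear (iprod v)"
  unfolding iprod_def by (rule adjoint_linear[OF linear_wedge_right])

text \<open>By duality: pairing with an arbitrary multivector turns the claim into linearity of
  \<open>mvec\<close> and of the wedge in its left factor.\<close>

lemma linear_iprod_left: "linear (\<lambda>v. iprod v X)"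
proof (rule linearI)
  show "iprod (v + w) X = iprod v X + iprod w X" for v w
    by (rule vector_eq_rdot[THEN iffD1])
      (simp add: inner_add_left inner_add_right iprod_inner linear_add[OF linear_mvec] linear_add[OF linear_wedge_left])
  show "iprod (r *\<^sub>R v) X = r *\<^sub>R iprod v X" for r v
    by (rule vector_eq_rdot[THEN iffD1])
      (simp add: iprod_inner linear_scale[OF linear_mvec] linear_scale[OF linear_wedge_left])
qed

lemma cs_expansion: "v = (\<Sum>i\<in>UNIV. v $ i *\<^sub>R bas i)"
  using basis_expansion[of v] by (simp add: scalar_mult_eq_scaleR)

lemma linear_eq_on_bas:
  fixes f f' :: "'n::finite cs \<Rightarrow> 'b::real_vector"
  assumes "linear f" "linear f'" "\<And>i. f (bas i) = f' (bas i)"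
  shows "f v = f' v"
  by (subst (1 2) cs_expansion[of v])
    (simp add: linear_sum[OF assms(1)] linear_sum[OF assms(2)] linear_scale[OF assms(1)]
      linear_scale[OF assms(2)] assms(3))

text \<open>Blades are the standard basis vectors for the index type \<open>'n set\<close>, so the
  statement for vectors applies verbatim.\<close>

lemma linear_eq_on_blades:
  fixes f f' :: "'n::finite mv \<Rightarrow> 'b::real_vector"
  assumes "linear f" "linear f'" "\<And>S. f (axis S 1) = f' (axis S 1)"
  shows "f X = f' X"
  using linear_eq_on_bas[OF assms] .

section \<open>Inversion signs, anticommutation and induction on multivectors\<close>

lemma wsign_empty [simp]: "wsign S {} = 1"
  by (simp add: wsign_def)

lemma wsign_square [simp]: "wsign S T * wsign S T = 1"
  by (simp add: wsign_def flip: power_mult_distrib)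

lemma wsign_square_left [simp]: "wsign S T * (wsign S T * r) = r"
  by (metis mult.assoc mult_1 wsign_square)

lemma wsign_singletons: "wsign {i} {j} = (if j < i then -1 else 1)"
proof -
  have "{(a, b). a \<in> {i} \<and> b \<in> {j} \<and> b < a} = (if j < i then {(i, j)} else {})" by auto
  then show ?thesis by (simp add: wsign_def)
qed

lemma wsign_insert_right:
  fixes S T :: "'n::{finite,linorder} set"
  assumes "x \<notin> T"
  shows "wsign S (insert x T) = wsign S {x} * wsign S T"
  using wsign_Un_right[of "{x}" T S] assms by simp

lemma wedge_left_cancel_square: "mvec v \<^bold>\<and> (mvec v \<^bold>\<and> X) = 0"
  by (simp flip: wedge_assoc add: wedge_mvec_self linear_0[OF linear_wedge_left])

lemma wedge_left_anticommute: "mvec v \<^bold>\<and> (mvec w \<^bold>\<and> X) = - (mvec w \<^bold>\<and> (mvec v \<^bold>\<and> X))"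
  unfolding wedge_assoc[symmetric] wedge_mvec_anticommute[of v w] linear_neg[OF linear_wedge_left] ..

lemma mv_induct [consumes 0, case_names add scale one wedge]:
  fixes X :: "'n::{finite,linorder} mv"
  assumes add: "\<And>X Y. P X \<Longrightarrow> P Y \<Longrightarrow> P (X + Y)"
    and scale: "\<And>r X. P X \<Longrightarrow> P (r *\<^sub>R X)"
    and one: "P (axis {} 1)"
    and wedge: "\<And>v X. P X \<Longrightarrow> P (mvec v \<^bold>\<and> X)"
  shows "P X"
proof -
  have blade: "P (axis S 1)" for S :: "'n set"
  proof (induction S rule: finite_induct[OF finite])
    case (2 x S)
    \<comment> \<open>The wedge itself produces \<open>wsign {x} S\<close>; since this sign squares
      to 1, scaling by it once more cancels it.\<close>
    have "wsign {x} S *\<^sub>R (mvec (bas x) \<^bold>\<and> axis S 1) = axis (insert x S) 1"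
      using 2 by (simp add: mvec_bas wedge_blades)
    then show ?case using scale[OF wedge[OF 2(3)]] by metis
  qed (rule one)
  have "P (\<Sum>S\<in>\<S>. X $ S *\<^sub>R axis S 1)" for \<S> :: "'n set set"
  proof (induction \<S> rule: finite_induct[OF finite])
    case 1
    \<comment> \<open>The empty sum is 0, obtained as 0 times the scalar 1.\<close>
    then show ?case using scale[OF one, of 0] by simp
  qed (auto intro: add scale blade)
  from this[of UNIV] show ?thesis by (simp flip: cs_expansion)
qed

section \<open>The interior product as an antiderivation\<close>

lemma bas_wedge_nth:
  "(mvec (bas i) \<^bold>\<and> X) $ R = (if i \<in> R then wsign {i} (R - {i}) * X $ (R - {i}) else 0)"
proof -
  have "(mvec (bas i) \<^bold>\<and> X) $ R = (\<Sum>S\<in>Pow R. if S = {i} then wsign {i} (R - {i}) * X $ (R - {i}) else 0)"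
    unfolding wedge_nth mvec_bas by (rule sum.cong) (auto simp: axis_def)
  then show ?thesis by (simp add: sum.delta)
qed

text \<open>The coordinate at \<open>R\<close> is the pairing with the blade of \<open>R\<close>,
  which the adjoint property moves onto a wedge of two blades.\<close>

lemma bas_iprod_nth:
  "iprod (bas i) X $ R = (if i \<in> R then 0 else wsign {i} R * X $ insert i R)"
proof -
  have "iprod (bas i) X $ R = iprod (bas i) X \<bullet> axis R 1"
    by (simp add: inner_axis)
  also have "\<dots> = (if i \<in> R then 0 else wsign {i} R * X $ insert i R)"
    unfolding iprod_inner by (simp add: mvec_bas wedge_blades inner_axis)
  finally show ?thesis .
qed

lemma iprod_bas_wedge:
  "iprod (bas i) (mvec (bas j) \<^bold>\<and> X) = (bas i \<bullet> bas j) *\<^sub>R X - mvec (bas j) \<^bold>\<and> iprod (bas i) X"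
proof (rule vec_eq_iff[THEN iffD2], rule allI)
  fix R
  show "iprod (bas i) (mvec (bas j) \<^bold>\<and> X) $ R
    = ((bas i \<bullet> bas j) *\<^sub>R X - mvec (bas j) \<^bold>\<and> iprod (bas i) X) $ R"
  \<comment> \<open>Only here do two different reorderings have to be compared; elsewhere terms
    vanish or a sign meets itself.\<close>
  proof (cases "i \<noteq> j \<and> i \<notin> R \<and> j \<in> R")
    case True
    define Q where "Q = R - {j}"
    have R: "R = insert j Q" "j \<notin> Q" "i \<notin> Q" "i \<noteq> j" using True by (auto simp: Q_def)
    have set_eq: "insert i (insert j Q) - {j} = insert i Q" "insert j Q - {j} = Q" using R by auto
    \<comment> \<open>For distinct indices exactly one of the two orders is an inversion; this is
      the source of the minus sign in the antiderivation rule.\<close>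
    have "wsign {i} {j} * wsign {j} {i} = -1" using R(4) by (auto simp: wsign_singletons)
    then have "(wsign {i} {j} * wsign {j} {i}) * (wsign {i} Q * wsign {j} Q * r) = - (wsign {i} Q * wsign {j} Q * r)" for r
      by simp
    then have "wsign {i} (insert j Q) * (wsign {j} (insert i Q) * r) = - (wsign {j} Q * (wsign {i} Q * r))" for r
      using R(2,3) by (simp add: wsign_insert_right[of j Q "{i}"] wsign_insert_right[of i Q "{j}"] mult_ac)
    with R(2-4) show ?thesis
      by (simp add: R(1) bas_wedge_nth bas_iprod_nth set_eq inner_axis_axis)
  next
    case False
    then consider "i = j" "i \<in> R" | "i = j" "i \<notin> R" | "i \<noteq> j" "i \<in> R" | "i \<noteq> j" "j \<notin> R" "i \<notin> R"
      by blast
    then show ?thesis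
      by cases (simp_all add: bas_wedge_nth bas_iprod_nth inner_axis_axis insert_absorb)
  qed
qed

text \<open>Both sides are linear in \<open>v\<close> and in \<open>w\<close>, so basis vectors
  suffice.\<close>

lemma iprod_wedge:
  "iprod v (mvec w \<^bold>\<and> X) = (v \<bullet> w) *\<^sub>R X - mvec w \<^bold>\<and> iprod v X"
proof -
  have lin_w: "linear (\<lambda>w. iprod v (mvec w \<^bold>\<and> X))"
    "linear (\<lambda>w. (v \<bullet> w) *\<^sub>R X - mvec w \<^bold>\<and> iprod v X)" for v
    by (rule linearI; simp add: linear_add[OF linear_mvec] linear_scale[OF linear_mvec]
        linear_add[OF linear_wedge_left] linear_scale[OF linear_wedge_left] linear_add[OF linear_iprod]
        linear_scale[OF linear_iprod] algebra_simps inner_add_right)+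
  have lin_v: "linear (\<lambda>v. iprod v (mvec w \<^bold>\<and> X))"
    "linear (\<lambda>v. (v \<bullet> w) *\<^sub>R X - mvec w \<^bold>\<and> iprod v X)" for w
    by (rule linear_iprod_left)
      (rule linearI; simp add: linear_add[OF linear_iprod_left] linear_scale[OF linear_iprod_left]
        linear_add[OF linear_wedge_right] linear_scale[OF linear_wedge_right] algebra_simps inner_add_left)
  show ?thesis
    by (rule linear_eq_on_bas[OF lin_w], rule linear_eq_on_bas[OF lin_v], rule iprod_bas_wedge)
qed

lemma iprod_one: "iprod v (axis {} 1) = 0"
  by (rule linear_eq_on_bas[OF linear_iprod_left linear_zero])
    (simp add: vec_eq_iff bas_iprod_nth, simp add: axis_def)

section \<open>The exterior extension as an algebra morphism\<close>

lemma wedge_list_Cons: "wedge_list (v # vs) = mvec v \<^bold>\<and> wedge_list vs"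
  by (simp add: wedge_list_def)

text \<open>Anticommutation moves \<open>v\<close> to the right until it meets its own copy, where
  the square vanishes.\<close>

lemma mvec_wedge_wedge_list_mem: "v \<in> set vs \<Longrightarrow> mvec v \<^bold>\<and> wedge_list vs = 0"
proof (induction vs)
  case (Cons w vs)
  then show ?case
    by (cases "v = w") (auto simp: wedge_list_Cons wedge_left_cancel_square
        wedge_left_anticommute[of v w] linear_0[OF linear_wedge_right])
qed simp

text \<open>Each exchange with a smaller index contributes -1, so sorting \<open>x\<close> into
  place accumulates exactly the inversion sign. The vectors \<open>f i\<close> are arbitrary, so
  this applies to the images under a linear map.\<close>

lemma mvec_wedge_wedge_list_insort:
  fixes f :: "'n::{finite,linorder} \<Rightarrow> 'n cs"
  assumes "sorted_wrt (<) xs" "x \<notin> set xs"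
  shows "mvec (f x) \<^bold>\<and> wedge_list (map f xs) = wsign {x} (set xs) *\<^sub>R wedge_list (map f (insort x xs))"
  using assms
proof (induction xs)
  case (Cons y ys)
  have y: "y \<notin> set ys" using Cons.prems by auto
  show ?case
  proof (cases "x < y")
    case True
    then have "{(i, j). i \<in> {x} \<and> j \<in> insert y (set ys) \<and> j < i} = {}"
      using Cons.prems by auto
    then have "wsign {x} (insert y (set ys)) = 1" unfolding wsign_def by (metis card.empty power_0)
    then show ?thesis using True by (simp add: wedge_list_Cons less_imp_le)
  next
    case False
    then have "y < x" using Cons.prems by auto
    then show ?thesis using Cons False y
      by (simp add: wedge_list_Cons wedge_left_anticommute[of "f x" "f y"] wsign_insert_right[of y "set ys" "{x}"]
          wsign_singletons linear_scale[OF linear_wedge_right])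
  qed
qed (simp add: wedge_list_Cons)

lemma ext_blade: "ext t (axis S 1) = wedge_list (map (\<lambda>i. t (bas i)) (sorted_list_of_set S))"
proof -
  have "ext t (axis S 1) = (\<Sum>T\<in>UNIV. if T = S
      then wedge_list (map (\<lambda>i. t (bas i)) (sorted_list_of_set S)) else 0)"
    unfolding ext_def by (rule sum.cong) (auto simp: axis_def)
  then show ?thesis by simp
qed

lemma ext_one: "ext t (axis {} 1) = axis {} 1"
  by (simp add: ext_blade wedge_list_def)

text \<open>By linearity take a basis vector and a blade. If the index repeats, both sides are 0;
  otherwise both need the same reordering sign.\<close>

lemma ext_wedge:
  assumes t: "linear t"
  shows "ext t (mvec v \<^bold>\<and> X) = mvec (t v) \<^bold>\<and> ext t X"
proof (rule linear_eq_on_bas[where v = v])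
  show "linear (\<lambda>v. ext t (mvec v \<^bold>\<and> X))" "linear (\<lambda>v. mvec (t v) \<^bold>\<and> ext t X)"
    by (rule linearI; simp add: linear_add[OF linear_mvec] linear_scale[OF linear_mvec]
        linear_add[OF linear_wedge_left] linear_scale[OF linear_wedge_left] linear_add[OF linear_ext]
        linear_scale[OF linear_ext] linear_add[OF t] linear_scale[OF t])+
next
  fix i
  show "ext t (mvec (bas i) \<^bold>\<and> X) = mvec (t (bas i)) \<^bold>\<and> ext t X"
  proof (rule linear_eq_on_blades[where X = X])
    show "linear (\<lambda>X. ext t (mvec (bas i) \<^bold>\<and> X))" "linear (\<lambda>X. mvec (t (bas i)) \<^bold>\<and> ext t X)"
      by (rule linearI; simp add: linear_add[OF linear_ext] linear_scale[OF linear_ext]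
        linear_add[OF linear_wedge_right] linear_scale[OF linear_wedge_right])+
  next
    fix S
    show "ext t (mvec (bas i) \<^bold>\<and> axis S 1) = mvec (t (bas i)) \<^bold>\<and> ext t (axis S 1)"
    proof (cases "i \<in> S")
      case True
      then show ?thesis
        by (simp add: mvec_bas wedge_blades ext_blade mvec_wedge_wedge_list_mem linear_0[OF linear_ext])
    next
      case False
      then show ?thesis
        using mvec_wedge_wedge_list_insort[of "sorted_list_of_set S" i "\<lambda>i. t (bas i)"]
        by (simp add: mvec_bas wedge_blades ext_blade linear_scale[OF linear_ext])
    qed
  qed
qed

lemma ext_comp:
  assumes "linear s" "linear t"
  shows "ext s (ext t X) = ext (s \<circ> t) X"
proof (induction X rule: mv_induct)
  case (wedge v X)
  show ?case
    unfolding ext_wedge[OF assms(1)] ext_wedge[OF assms(2)] wedge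
      ext_wedge[OF linear_compose[OF assms(2,1)]] by simp
qed (simp_all add: linear_add[OF linear_ext] linear_scale[OF linear_ext] ext_one)

lemma ext_id: "ext id X = X"
proof (induction X rule: mv_induct)
  case (wedge v X)
  show ?case unfolding ext_wedge[OF linear_id] wedge by simp
qed (simp_all add: linear_add[OF linear_ext] linear_scale[OF linear_ext] ext_one)

text \<open>Induction on \<open>X\<close>: the antiderivation rule applies on both sides, and its
  scalar terms agree by the definition of the adjoint.\<close>

lemma iprod_ext:
  assumes t: "linear t"
  shows "iprod v (ext t X) = ext t (iprod (adjoint t v) X)"
proof (induction X rule: mv_induct)
  case (wedge w X)
  have "v \<bullet> t w = adjoint t v \<bullet> w" by (simp add: adjoint_clauses[OF t])
  then show ?case using wedge
    by (simp add: ext_wedge t iprod_wedge linear_diff[OF linear_ext] linear_scale[OF linear_ext])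
qed (simp_all add: linear_add[OF linear_ext] linear_scale[OF linear_ext] ext_one iprod_one
      linear_add[OF linear_iprod] linear_scale[OF linear_iprod] linear_0[OF linear_ext])

section \<open>Locality of the derivatives\<close>

lemma partial_cong_open:
  assumes "open W" "x \<in> W" "\<And>y. y \<in> W \<Longrightarrow> F y = G y"
  shows "partial \<mu> F x = partial \<mu> G x"
proof -
  have "((\<lambda>t. x + t *\<^sub>R axis \<mu> 1) \<longlongrightarrow> x + 0 *\<^sub>R axis \<mu> 1) (nhds (0::real))"
    by (intro tendsto_intros filterlim_ident)
  \<comment> \<open>For small \<open>t\<close> the coordinate line stays in \<open>W\<close>, and
    the derivative at 0 depends only on such \<open>t\<close>.\<close>
  then have "\<forall>\<^sub>F t in nhds (0::real). x + t *\<^sub>R axis \<mu> 1 \<in> W"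
    using assms(1,2) by (auto dest: topological_tendstoD)
  then have "\<forall>\<^sub>F t in nhds (0::real). F (x + t *\<^sub>R axis \<mu> 1) = G (x + t *\<^sub>R axis \<mu> 1)"
    by eventually_elim (rule assms(3))
  then show ?thesis
    unfolding partial_def by (intro vector_derivative_cong_eq) auto
qed

lemma lc_deriv_cong_open:
  assumes c: "is_chart c" and U: "open U" "U \<subseteq> fst c" and p: "p \<in> U"
    and eq: "\<And>q. q \<in> U \<Longrightarrow> X q = Y q"
  shows "lc_deriv c g a X p = lc_deriv c g a Y p"
proof -
  have hom: "homeomorphism (fst c) (snd c ` fst c) (snd c) (chart_inv c)"
    and op: "open (snd c ` fst c)"
    using c by (auto simp: is_chart_def)
  \<comment> \<open>The chart is an open map onto its open image, so equality on \<open>U\<close>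
    becomes equality on an open coordinate set.\<close>
  have "openin (top_of_set (snd c ` fst c)) (snd c ` U)"
    using homeomorphism_imp_open_map[OF hom] U openin_open_eq c by (auto simp: is_chart_def)
  then have "open (snd c ` U)" using op by (rule openin_open_trans)
  moreover have "(X \<circ> chart_inv c) y = (Y \<circ> chart_inv c) y" if "y \<in> snd c ` U" for y
    using that U hom eq by (auto simp: homeomorphism_def)
  ultimately have "partial \<mu> (X \<circ> chart_inv c) (snd c p) = partial \<mu> (Y \<circ> chart_inv c) (snd c p)" for \<mu>
    using p by (intro partial_cong_open) auto
  then show ?thesis using eq[OF p] by (simp add: lc_deriv_def dird_def)
qed

section \<open>Inverses, adjoints and the gauge identities\<close>

lemma bij_of_det_nonzero:
  fixes t :: "'n::finite cs \<Rightarrow> 'n cs"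
  assumes "linear t" "det (matrix t) \<noteq> 0"
  shows "bij t"
  using assms det_nz_iff_inj[of t] linear_injective_imp_surjective[of t] by (auto simp: bij_def)

lemma linear_inv:
  fixes t :: "'n::finite cs \<Rightarrow> 'n cs"
  assumes "linear t" "bij t"
  shows "linear (inv t)"
  using assms by (metis bij_is_inj inj_linear_imp_inv_linear)

lemma linear_star:
  fixes t :: "'n::finite cs \<Rightarrow> 'n cs"
  assumes "linear t" "bij t"
  shows "linear (star t)"
  unfolding star_def by (intro adjoint_linear linear_inv assms)

lemma adjoint_star:
  fixes t :: "'n::finite cs \<Rightarrow> 'n cs"
  assumes "linear t" "bij t"
  shows "adjoint (star t) = inv t"
  unfolding star_def by (intro adjoint_adjoint linear_inv assms)

lemma adjoint_comp_star:
  fixes t :: "'n::finite cs \<Rightarrow> 'n cs"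
  assumes "linear t" "bij t"
  shows "adjoint t \<circ> star t = id"
proof (rule ext)
  fix v
  show "(adjoint t \<circ> star t) v = id v"
  proof (rule vector_eq_rdot[THEN iffD1], rule allI)
    show "(adjoint t \<circ> star t) v \<bullet> w = id v \<bullet> w" for w
      using assms
      by (simp add: star_def adjoint_clauses[OF assms(1)] adjoint_clauses[OF linear_inv[OF assms]] bij_is_inj)
  qed
qed

text \<open>The cancellation of \<open>ext (adjoint (h q))\<close> against
  \<open>ext (star (h q))\<close> holds at all points of the open set \<open>U\<close>, not only at
  \<open>p\<close>, so it may be used under the derivative.\<close>

lemma gauge_deriv_star:
  assumes c: "is_chart c" and U: "open U" "U \<subseteq> fst c" and p: "p \<in> U"
    and h: "\<And>q. q \<in> U \<Longrightarrow> linear (h q)" "\<And>q. q \<in> U \<Longrightarrow> bij (h q)"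
  shows "gauge_deriv c g h a (\<lambda>q. ext (star (h q)) (X q)) p = ext (star (h p)) (lc_deriv c g a X p)"
proof -
  have "ext (adjoint (h q)) (ext (star (h q)) (X q)) = X q" if "q \<in> U" for q
    using h[OF that] by (simp add: ext_comp linear_star adjoint_linear adjoint_comp_star ext_id)
  then have "lc_deriv c g a (\<lambda>q. ext (adjoint (h q)) (ext (star (h q)) (X q))) p = lc_deriv c g a X p"
    by (rule lc_deriv_cong_open[OF c U p])
  then show ?thesis by (simp add: gauge_deriv_def)
qed

lemma inv_gauge_metric:
  fixes h \<eta> :: "'n::finite cs \<Rightarrow> 'n cs"
  assumes h: "linear h" "bij h" and \<eta>: "bij \<eta>" "\<eta> = inv \<eta>"
    and g: "bij g" "g = adjoint h \<circ> \<eta> \<circ> h"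
  shows "inv g b = inv h (\<eta> (star h b))"
proof (rule inv_f_eq[OF bij_is_inj[OF g(1)]])
  \<comment> \<open>A bijection equal to its inverse is an involution; this removes both copies of
    \<open>\<eta>\<close> when \<open>g\<close> is applied to the candidate.\<close>
  have "\<eta> (\<eta> v) = v" for v using \<eta> by (metis bij_inv_eq_iff)
  then show "g (inv h (\<eta> (star h b))) = b"
    using adjoint_comp_star[OF h] h(2) by (simp add: g(2) bij_is_surj surj_f_inv_f fun_eq_iff)
qed

text \<open>The adjoint of \<open>star h\<close> is \<open>inv h\<close>, so moving the contraction
  inside the extension turns \<open>\<eta> (star h b)\<close> into
  \<open>inv h (\<eta> (star h b))\<close>, which is \<open>inv g b\<close>.\<close>

lemma iprod_metric_gauge:
  assumes h: "linear h" "bij h" and \<eta>: "bij \<eta>" "\<eta> = inv \<eta>"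
    and g: "bij g" "g = adjoint h \<circ> \<eta> \<circ> h"
  shows "ext (star h) (iprod_metric (inv g) b X) = iprod_metric \<eta> (star h b) (ext (star h) X)"
  by (simp add: iprod_metric_def iprod_ext linear_star adjoint_star h inv_gauge_metric[OF h \<eta> g])

theorem mainTheorem12:
  fixes A :: "('m::{t2_space,second_countable_topology}, 'n::{finite,linorder}) chart set"
    and c :: "('m, 'n) chart"
    and U :: "'m set"
    and g \<eta> h :: "'m \<Rightarrow> 'n cs \<Rightarrow> 'n cs"
    and X :: "'m \<Rightarrow> 'n mv"
  assumes manifold: "smooth_atlas A" and chart: "c \<in> A"
    and metric: "metric_structure c U g"
    and gauge: "gauge_metric_field c U g \<eta> h"
    and smooth: "smooth_field c U X"
  shows "(\<forall>p\<in>U. ext (star (h p)) (lc_div c g X p) = gauge_div c g \<eta> h (\<lambda>q. ext (star (h q)) (X q)) p)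
       \<and> (\<forall>p\<in>U. ext (star (h p)) (lc_curl c g X p) = gauge_curl c g h (\<lambda>q. ext (star (h q)) (X q)) p)
       \<and> (\<forall>p\<in>U. ext (star (h p)) (lc_grad c g X p) = gauge_grad c g \<eta> h (\<lambda>q. ext (star (h q)) (X q)) p)"
proof -
  have c: "is_chart c" using manifold chart by (simp add: smooth_atlas_def)
  have U: "open U" "U \<subseteq> fst c" using metric by (auto simp: metric_structure_def)
  have bij: "bij (t p)" if "extensor_field c U t" "nonsingular_on U t" "p \<in> U" for t p
    using that by (intro bij_of_det_nonzero) (auto simp: extensor_field_def nonsingular_on_def)
  note gauge' = gauge[unfolded gauge_metric_field_def]
  have \<eta>': "orthogonal_metric_field c U \<eta>" using gauge' by blast
  have h: "linear (h p)" "bij (h p)" if "p \<in> U" for p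
    using gauge' that bij unfolding extensor_field_def by blast+
  have \<eta>: "bij (\<eta> p)" "\<eta> p = inv (\<eta> p)" if "p \<in> U" for p
    using \<eta>' that bij unfolding orthogonal_metric_field_def metric_field_def by blast+
  have g: "bij (g p)" "g p = adjoint (h p) \<circ> \<eta> p \<circ> h p" if "p \<in> U" for p
    using metric gauge' that bij unfolding metric_structure_def metric_field_def by blast+
  \<comment> \<open>These three rules match the sums term by term: the derivative, the contraction
    and the wedge; the Clifford case adds the last two.\<close>
  note deriv = gauge_deriv_star[OF c U _ h]
  note inner = iprod_metric_gauge[OF h \<eta> g]
  note outer = ext_wedge[OF linear_star[OF h]]
  show ?thesis
    by (simp add: lc_div_def gauge_div_def lc_curl_def gauge_curl_def lc_grad_def gauge_grad_def
        clifford_def linear_sum[OF linear_ext] linear_add[OF linear_ext] deriv inner outer)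
qed

end
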